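(* Let $\mathcal{S}\subseteq\mathbb{R}^2$ be a Lebesgue measurable set of infinite two-dimensional Lebesgue measure. Then $\mathcal{S}$ contains the four vertices of a (non-degenerate) cyclic quadrilateral of area $1$; that is, there exist four pairwise distinct points of $\mathcal{S}$ that lie on a common circle and are the vertices of a quadrilateral inscribed in that circle whose area equals $1$.
   Context: A cyclic quadrilateral is a quadrilateral whose four vertices lie on a common circle, its vertices being listed in the order in which they appear along the circle (so it is convex and its area is the area of the convex hull of the four points). The quadrilateral is required to be non-degenerate, i.e. all $4$ of its vertices are different. *)

theory Defs
  imports "HOL-Analysis.Analysis"
begin

definition circle_point :: "real^2 \<Rightarrow> real \<Rightarrow> real \<Rightarrow> real^2" where
  "circle_point c r t = c + vector [r * cos t, r * sin t]"

text \<open>The four points are met in the order A, B, C, D during a single counterclockwise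
  turn around the circle with centre c and radius r.\<close>

definition ccw_on_circle ::
    "real^2 \<Rightarrow> real \<Rightarrow> real^2 \<Rightarrow> real^2 \<Rightarrow> real^2 \<Rightarrow> real^2 \<Rightarrow> bool" where
  "ccw_on_circle c r A B C D \<longleftrightarrow>
    (\<exists>t1 t2 t3 t4. t1 < t2 \<and> t2 < t3 \<and> t3 < t4 \<and> t4 < t1 + 2 * pi \<and>
      A = circle_point c r t1 \<and> B = circle_point c r t2 \<and>
      C = circle_point c r t3 \<and> D = circle_point c r t4)"

text \<open>The vertices may be listed in either direction. Distinctness and membership in the
  circle already follow from the ordering condition; they are repeated for readability.\<close>

definition cyclic_quadrilateral :: "real^2 \<Rightarrow> real^2 \<Rightarrow> real^2 \<Rightarrow> real^2 \<Rightarrow> bool" where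
  "cyclic_quadrilateral A B C D \<longleftrightarrow>
    distinct [A, B, C, D] \<and>
    (\<exists>c r. 0 < r \<and> {A, B, C, D} \<subseteq> sphere c r \<and>
      (ccw_on_circle c r A B C D \<or> ccw_on_circle c r D C B A))"

text \<open>A cyclic quadrilateral is convex, so the region it bounds is the convex hull of
  its vertices.\<close>

definition quadrilateral_area :: "real^2 \<Rightarrow> real^2 \<Rightarrow> real^2 \<Rightarrow> real^2 \<Rightarrow> real" where
  "quadrilateral_area A B C D = measure lebesgue (convex hull {A, B, C, D})"

end

theory Submission
  imports Defs
begin

text \<open>
  Fix a compact \<open>K \<subseteq> S\<close> of positive measure, and far away from it two points \<open>C, D\<close> of
  \<open>S\<close> that are extremely close to each other, with \<open>D - C\<close> roughly perpendicular to the direction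
  in which \<open>K\<close> is seen from \<open>C\<close>. The circles through \<open>C\<close> and \<open>D\<close> foliate the neighbourhood of
  \<open>K\<close>, nearly perpendicularly to that direction. Given \<open>A\<close> near \<open>K\<close>, slide a
  point \<open>B\<close> away from \<open>A\<close> along the circle through \<open>A, C, D\<close>: the quadrilateral \<open>D A B C\<close> is
  almost the triangle \<open>A B C\<close> of height about \<open>R = |C|\<close>, so its area becomes \<open>1\<close> when \<open>B\<close> is at
  distance about \<open>2 / R\<close> from \<open>A\<close>. This defines a map \<open>F: A \<mapsto> B\<close>, and all that is missing is a
  point \<open>A \<in> K\<close> with \<open>F A \<in> K\<close>.
  
  Such a point exists because a set of positive measure cannot be moved off itself by a map that
  is close enough to the identity and does not crush distances
  (\<open>expanding_near_identity_recurrence\<close>): otherwise the image would lie in \<open>U - K\<close> for an open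
  \<open>U \<supseteq> K\<close> with \<open>U - K\<close> of tiny measure. How close is enough depends on \<open>K\<close> only, so \<open>K\<close> can be
  chosen before \<open>C\<close> and \<open>D\<close>. The map \<open>F\<close> qualifies for large \<open>R\<close>, because the displacement
  \<open>F A - A\<close> is both small and Lipschitz with a small constant (\<open>unit_area_displacement\<close>): the two
  conditions on \<open>B\<close> reduce to one quadratic equation with a well separated small root. The same
  recurrence principle, applied to \<open>x \<mapsto> x + t J x\<close> with \<open>J\<close> the rotation by a right angle, yields
  the pair \<open>C, D\<close> (\<open>close_perpendicular_pair_far_out\<close>).
  
  The remaining work translates signs of orientations into the cyclic order of the vertices and
  into the area of the convex hull (\<open>cyclic_quadrilateral_if_oriented\<close>).
\<close>

section \<open>Recurrence of sets of positive measure\<close>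

text \<open>
  The inverse of \<open>f\<close> is \<open>L\<close>-Lipschitz on \<open>f ` X\<close>, so this is the usual distortion bound for
  Lipschitz maps, up to the constant. By Vitali's lemma \<open>f ` X\<close> is covered by fivefold enlargements
  of disjoint balls inside \<open>W\<close>, and pulling an enlarged ball back costs a factor \<open>L\<close> in its radius.
\<close>

lemma measure_le_of_expanding_image:
  fixes f :: "'a::euclidean_space \<Rightarrow> 'a"
  assumes X: "compact X" and W: "open W" "W \<in> lmeasurable" and sub: "f ` X \<subseteq> W"
    and L: "0 < L" "\<And>x y. x \<in> X \<Longrightarrow> y \<in> X \<Longrightarrow> dist x y \<le> L * dist (f x) (f y)"
  shows "measure lebesgue X \<le> (5 * L) ^ DIM('a) * measure lebesgue W"
proof -
  have "\<exists>r. 0 < r \<and> r \<le> 1 \<and> ball (f x) r \<subseteq> W" if "x \<in> X" for x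
  proof -
    have "f x \<in> W"
      using sub that by blast
    then obtain e where "0 < e" "ball (f x) e \<subseteq> W"
      by (rule openE[OF W(1)])
    then show ?thesis
      by (intro exI[of _ "min e 1"]) (auto simp: subset_iff)
  qed
  then obtain r where r: "\<And>x. x \<in> X \<Longrightarrow> 0 < r x \<and> r x \<le> 1 \<and> ball (f x) (r x) \<subseteq> W"
    by metis
  have cov: "f ` X \<subseteq> (\<Union>x\<in>X. ball (f x) (r x))"
    using r by force
  obtain C where C: "C \<subseteq> X" "pairwise (\<lambda>i j. disjnt (ball (f i) (r i)) (ball (f j) (r j))) C"
      "f ` X \<subseteq> (\<Union>i\<in>C. ball (f i) (5 * r i))"
    by (rule Vitali_covering_lemma_balls[OF cov, of 1]) (use r that in \<open>blast+\<close>)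
  have "X \<subseteq> (\<Union>c\<in>C. ball c (5 * L * r c))"
  proof
    fix x assume x: "x \<in> X"
    then obtain c where c: "c \<in> C" "dist (f c) (f x) < 5 * r c"
      using C(3) by force
    have "dist c x \<le> L * dist (f c) (f x)"
      using L(2) C(1) c(1) x by blast
    also have "\<dots> < L * (5 * r c)"
      using c(2) L(1) by simp
    finally show "x \<in> (\<Union>c\<in>C. ball c (5 * L * r c))"
      using c(1) by (auto simp: mult_ac)
  qed
  then obtain F where F: "F \<subseteq> C" "finite F" "X \<subseteq> (\<Union>c\<in>F. ball c (5 * L * r c))"
    using compactE_image[OF X, of C "\<lambda>c. ball c (5 * L * r c)"] by auto
  have FX: "F \<subseteq> X"
    using F(1) C(1) by blast
  have "measure lebesgue X \<le> measure lebesgue (\<Union>c\<in>F. ball c (5 * L * r c))"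
    using F X by (intro measure_mono_fmeasurable)
      (auto intro!: fmeasurable.finite_UN simp: fmeasurableD lmeasurable_compact)
  also have "\<dots> \<le> (\<Sum>c\<in>F. measure lebesgue (ball c (5 * L * r c)))"
    using F(2) by (intro measure_UNION_le) auto
  also have "\<dots> = (\<Sum>c\<in>F. (5 * L) ^ DIM('a) * measure lebesgue (ball (f c) (r c)))"
    using FX r L(1)
    by (intro sum.cong refl) (auto simp: content_ball power_mult_distrib less_imp_le subset_iff)
  also have "\<dots> = (5 * L) ^ DIM('a) * (\<Sum>c\<in>F. measure lebesgue (ball (f c) (r c)))"
    by (simp add: sum_distrib_left)
  also have "(\<Sum>c\<in>F. measure lebesgue (ball (f c) (r c))) = measure lebesgue (\<Union>c\<in>F. ball (f c) (r c))"
    using F C(2) pairwise_subset[OF C(2) F(1)]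
    by (intro measure_UNION'[symmetric]) auto
  also have "\<dots> \<le> measure lebesgue W"
    using F FX r W(2) by (intro measure_mono_fmeasurable) (auto simp: subset_iff)
  finally show ?thesis
    using L(1) by (simp add: mult_left_mono)
qed

text \<open>
  The radius \<open>\<eta>\<close> depends on \<open>K\<close> and \<open>L\<close> but not on the map. This uniformity is what makes the lemma
  useful: the maps to which it is applied are constructed only after \<open>\<eta>\<close> is known.
\<close>

lemma expanding_near_identity_recurrence:
  fixes K :: "'a::euclidean_space set"
  assumes K: "compact K" "0 < measure lebesgue K" and L: "0 < L"
  obtains \<eta> where "0 < \<eta>"
    "\<And>f. \<lbrakk>\<And>x. x \<in> K \<Longrightarrow> dist x (f x) < \<eta>;
          \<And>x y. x \<in> K \<Longrightarrow> y \<in> K \<Longrightarrow> dist x y \<le> L * dist (f x) (f y)\<rbrakk>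
        \<Longrightarrow> \<exists>x\<in>K. f x \<in> K"
proof -
  define \<epsilon> where "\<epsilon> = measure lebesgue K / (5 * L) ^ DIM('a)"
  have "0 < \<epsilon>"
    using K(2) L by (simp add: \<epsilon>_def)
  have "K \<in> sets lebesgue"
    using K(1) by (simp add: fmeasurableD lmeasurable_compact)
  then obtain U where U: "open U" "K \<subseteq> U" "U - K \<in> lmeasurable"
      "emeasure lebesgue (U - K) < ennreal \<epsilon>"
    using sets_lebesgue_outer_open[OF _ \<open>0 < \<epsilon>\<close>] by blast
  have small: "measure lebesgue (U - K) < \<epsilon>"
    using U(3,4) by (metis emeasure_eq_measure2 ennreal_less_iff measure_nonneg)
  obtain \<eta> where \<eta>: "0 < \<eta>" "(\<Union>x\<in>K. ball x \<eta>) \<subseteq> U"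
    using compact_subset_open_imp_ball_epsilon_subset[OF K(1) U(1,2)] by blast
  show thesis
  proof
    fix f assume near: "\<And>x. x \<in> K \<Longrightarrow> dist x (f x) < \<eta>"
      and expand: "\<And>x y. x \<in> K \<Longrightarrow> y \<in> K \<Longrightarrow> dist x y \<le> L * dist (f x) (f y)"
    show "\<exists>x\<in>K. f x \<in> K"
    proof (rule ccontr)
      assume "\<not> ?thesis"
      then have "f ` K \<subseteq> U - K"
        using near \<eta>(2) by fastforce
      then have "measure lebesgue K \<le> (5 * L) ^ DIM('a) * measure lebesgue (U - K)"
        using K(1) U L expand
        by (intro measure_le_of_expanding_image) (auto simp: compact_imp_closed)
      also have "\<dots> < (5 * L) ^ DIM('a) * \<epsilon>"
        using small L by simp
      also have "\<dots> = measure lebesgue K"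
        using L by (simp add: \<epsilon>_def)
      finally show False
        by simp
    qed
  qed (rule \<eta>(1))
qed

text \<open>
  Removing a ball leaves infinite measure, and a closed set fills the rest up to measure \<open>1\<close>. Its
  intersections with large balls are compact and cannot all be null.
\<close>

lemma compact_of_positive_measure_far_out:
  fixes S :: "'a::euclidean_space set"
  assumes S: "S \<in> sets lebesgue" "emeasure lebesgue S = \<infinity>"
  obtains K where "compact K" "K \<subseteq> S" "0 < measure lebesgue K" "\<And>x. x \<in> K \<Longrightarrow> R < norm x"
proof -
  let ?S' = "S - cball 0 R"
  have fin: "emeasure lebesgue (cball (0::'a) R) < \<infinity>"
    using lmeasurable_cball[of "0::'a" R] by (simp add: fmeasurable_def)
  have S': "?S' \<in> sets lebesgue"
    using S(1) by auto
  have "emeasure lebesgue S \<le> emeasure lebesgue (?S' \<union> cball 0 R)"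
    using S(1) by (intro emeasure_mono) auto
  also have "\<dots> = emeasure lebesgue ?S' + emeasure lebesgue (cball (0::'a) R)"
    by (rule plus_emeasure[symmetric]) (use S' in auto)
  finally have inf': "emeasure lebesgue ?S' = \<infinity>"
    using fin S(2) by (auto simp: top_unique)
  obtain T where T: "closed T" "T \<subseteq> ?S'" "?S' - T \<in> lmeasurable"
    "emeasure lebesgue (?S' - T) < ennreal 1"
    using sets_lebesgue_inner_closed[OF S', of 1] by auto
  have Tm: "T \<in> sets lebesgue"
    using T(1) by (simp add: lborelD borel_closed)
  have "emeasure lebesgue ?S' \<le> emeasure lebesgue T + emeasure lebesgue (?S' - T)"
    using plus_emeasure[OF Tm, of "?S' - T"] S' Tm T(2) by (simp add: Un_absorb1)
  then have "emeasure lebesgue T = \<infinity>"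
    using inf' T(4) by (auto simp: top_unique)
  have "\<exists>n::nat. emeasure lebesgue (T \<inter> cball 0 (real n)) \<noteq> 0"
  proof (rule ccontr)
    assume "\<not> ?thesis"
    then have "(\<Union>n::nat. T \<inter> cball 0 (real n)) \<in> null_sets lebesgue"
      using Tm by (intro null_sets_UN) (auto simp: null_sets_def)
    moreover have "(\<Union>n::nat. T \<inter> cball 0 (real n)) = T"
      using real_arch_simple by auto
    ultimately show False
      using \<open>emeasure lebesgue T = \<infinity>\<close> by auto
  qed
  then obtain n :: nat where n: "emeasure lebesgue (T \<inter> cball 0 (real n)) \<noteq> 0"
    by blast
  have comp: "compact (T \<inter> cball 0 (real n))"
    using T(1) by (simp add: closed_Int_compact)
  show thesis
  proof
    show "0 < measure lebesgue (T \<inter> cball 0 (real n))"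
      using n emeasure_eq_measure2[OF lmeasurable_compact[OF comp]]
      by (metis ennreal_0 measure_nonneg order_le_less)
  qed (use comp T(2) in auto)
qed

section \<open>Orientation and area\<close>

text \<open>
  Twice the signed area of the triangle \<open>A B C\<close>, positive when the vertices run counterclockwise.
\<close>

definition orient :: "real^2 \<Rightarrow> real^2 \<Rightarrow> real^2 \<Rightarrow> real" where
  "orient A B C = (B$1 - A$1) * (C$2 - A$2) - (B$2 - A$2) * (C$1 - A$1)"
section \<open>Four points on a circle\<close>

lemma circle_point_component [simp]:
  "circle_point c r t $ 1 = c $ 1 + r * cos t" "circle_point c r t $ 2 = c $ 2 + r * sin t"
  by (simp_all add: circle_point_def)

lemma sphere_point_is_circle_point:
  assumes "P \<in> sphere c r" "0 < r"
  obtains t where "t0 \<le> t" "t < t0 + 2 * pi" "P = circle_point c r t"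
proof -
  have "(P$1 - c$1)\<^sup>2 + (P$2 - c$2)\<^sup>2 = r\<^sup>2"
    using assms by (auto simp: dist_norm norm_vec_def L2_set_def sum_2 power2_commute)
  then have "((P$1 - c$1) / r)\<^sup>2 + ((P$2 - c$2) / r)\<^sup>2 = 1"
    using assms(2) by (simp add: power_divide add_divide_distrib[symmetric])
  then obtain u where u: "(P$1 - c$1) / r = cos u" "(P$2 - c$2) / r = sin u"
    by (rule sincos_total_2pi)
  have Pu: "P = circle_point c r u"
    using u assms(2) by (simp add: vec_eq_iff forall_2 field_simps)
  define k where "k = \<lfloor>(u - t0) / (2 * pi)\<rfloor>"
  define t where "t = u - 2 * pi * of_int k"
  have k: "of_int k \<le> (u - t0) / (2 * pi)" "(u - t0) / (2 * pi) < of_int k + 1"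
    by (simp_all add: k_def)
  have "t0 \<le> t" "t < t0 + 2 * pi"
    using k by (simp_all add: t_def field_simps)
  moreover have "cos t = cos u" "sin t = sin u"
    unfolding t_def by (simp_all add: cos_diff sin_diff)
  then have "P = circle_point c r t"
    using Pu by (simp add: circle_point_def)
  ultimately show thesis
    using that by blast
qed

text \<open>
  The area of an inscribed triangle is \<open>2 r\<^sup>2\<close> times the product of the sines of its angles, and
  by the inscribed angle theorem these angles are half the differences of the parameters.
\<close>

lemma orient_circle_point:
  "orient (circle_point c r a) (circle_point c r b) (circle_point c r d)
     = 4 * r\<^sup>2 * (sin ((b - a) / 2) * sin ((d - b) / 2) * sin ((d - a) / 2))"
proof -
  define x y where "x = (b - a) / 2" and "y = (d - b) / 2"
  have b: "b = a + 2 * x" and d: "d = a + 2 * x + 2 * y" and xy: "(d - a) / 2 = x + y"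
    by (simp_all add: x_def y_def field_simps)
  have "orient (circle_point c r a) (circle_point c r b) (circle_point c r d)
      = r\<^sup>2 * ((cos b - cos a) * (sin d - sin a) - (sin b - sin a) * (cos d - cos a))"
    by (simp add: orient_def algebra_simps power2_eq_square)
  also have "(cos b - cos a) * (sin d - sin a) - (sin b - sin a) * (cos d - cos a)
      = sin (b - a) + sin (d - b) - sin (d - a)"
    by (simp add: sin_diff algebra_simps)
  also have "\<dots> = sin (2 * x) + sin (2 * y) - sin (2 * x + 2 * y)"
    by (simp add: b d)
  also have "\<dots> = sin (2 * x) * (1 - cos (2 * y)) + sin (2 * y) * (1 - cos (2 * x))"
    by (simp add: sin_add algebra_simps)
  also have "\<dots> = 4 * (sin x * sin y * sin (x + y))"
    unfolding cos_double_sin sin_double sin_add by (simp add: power2_eq_square algebra_simps)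
  finally show ?thesis
    unfolding xy x_def[symmetric] y_def[symmetric] by simp
qed

text \<open>
  Within one turn starting at \<open>a\<close>, orientation detects the order of the parameters. This holds because
  the half differences from \<open>a\<close> lie in \<open>{0..<pi}\<close>, where the sine is nonnegative.
\<close>

lemma orient_circle_point_pos_iff:
  assumes r: "0 < r" and "0 \<le> b - a" "b - a < 2 * pi" "0 \<le> d - a" "d - a < 2 * pi"
  shows "0 < orient (circle_point c r a) (circle_point c r b) (circle_point c r d)
      \<longleftrightarrow> a < b \<and> b < d"
proof
  assume ord: "a < b \<and> b < d"
  have "0 < sin ((b - a) / 2)" "0 < sin ((d - b) / 2)" "0 < sin ((d - a) / 2)"
    using assms ord by (intro sin_gt_zero; simp)+
  then show "0 < orient (circle_point c r a) (circle_point c r b) (circle_point c r d)"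
    using r by (simp add: orient_circle_point)
next
  assume pos: "0 < orient (circle_point c r a) (circle_point c r b) (circle_point c r d)"
  have ge: "0 \<le> sin ((b - a) / 2)" "0 \<le> sin ((d - a) / 2)"
    using assms by (intro sin_ge_zero; simp)+
  have *: "0 < sin ((b - a) / 2) * sin ((d - b) / 2) * sin ((d - a) / 2)"
    using pos r by (simp add: orient_circle_point zero_less_mult_iff)
  then have "a \<noteq> b"
    by auto
  moreover have "b < d"
  proof (rule ccontr)
    assume "\<not> b < d"
    then have "0 \<le> sin ((b - d) / 2)"
      using assms by (intro sin_ge_zero; simp)
    moreover have "sin ((d - b) / 2) = - sin ((b - d) / 2)"
      by (metis minus_diff_eq minus_divide_left sin_minus)
    ultimately have "sin ((b - a) / 2) * sin ((d - b) / 2) * sin ((d - a) / 2) \<le> 0"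
      using ge by (simp add: mult_nonneg_nonneg)
    with * show False
      by simp
  qed
  ultimately show "a < b \<and> b < d"
    using assms by auto
qed

text \<open>
  The hypothesis says that the diagonals \<open>A C\<close> and \<open>B D\<close> meet. In a convex combination of the four
  points, the weights on \<open>B\<close> and \<open>D\<close> can be traded for weights on \<open>A\<close> and \<open>C\<close> by way of that common
  point, until one of \<open>B\<close> and \<open>D\<close> has weight \<open>0\<close>.
\<close>

lemma convex_hull_quadrilateral_split:
  fixes A B C D :: "'a::real_vector"
  assumes X: "(1 - t) *\<^sub>R A + t *\<^sub>R C = (1 - s) *\<^sub>R B + s *\<^sub>R D"
    and t: "0 \<le> t" "t \<le> 1" and s: "0 < s" "s < 1"
  shows "convex hull {A, B, C, D} = convex hull {A, B, C} \<union> convex hull {A, C, D}"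
proof (intro equalityI subsetI)
  fix z assume "z \<in> convex hull {A, B, C, D}"
  then obtain a b c d where abcd: "0 \<le> a" "0 \<le> b" "0 \<le> c" "0 \<le> d" "a + b + c + d = 1"
    and z: "z = a *\<^sub>R A + b *\<^sub>R B + c *\<^sub>R C + d *\<^sub>R D"
  proof -
    obtain u v w p q r where h: "0 \<le> u" "0 \<le> v" "u + v = 1" "0 \<le> p" "0 \<le> q" "0 \<le> r" "p + q + r = 1"
      "z = u *\<^sub>R A + v *\<^sub>R (p *\<^sub>R B + q *\<^sub>R C + r *\<^sub>R D)"
      using \<open>z \<in> _\<close> by (auto simp: convex_hull_insert[of "{B, C, D}" A] convex_hull_3)
    have "u + v * p + v * q + v * r = u + v * (p + q + r)"
      by (simp add: algebra_simps)
    then show thesis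
      using h that[of u "v * p" "v * q" "v * r"] by (simp add: scaleR_add_right)
  qed
  have trade: "b *\<^sub>R B + d *\<^sub>R D
      = (b - m * (1 - s)) *\<^sub>R B + (d - m * s) *\<^sub>R D + (m * (1 - t)) *\<^sub>R A + (m * t) *\<^sub>R C" for m
  proof -
    have "m *\<^sub>R ((1 - t) *\<^sub>R A + t *\<^sub>R C) = m *\<^sub>R ((1 - s) *\<^sub>R B + s *\<^sub>R D)"
      using X by simp
    then show ?thesis
      by (simp add: scaleR_add_right scaleR_diff_left algebra_simps)
  qed
  show "z \<in> convex hull {A, B, C} \<union> convex hull {A, C, D}"
  proof (cases "d * (1 - s) \<le> b * s")
    case True
    define m where "m = d / s"
    have m: "0 \<le> m" "d - m * s = 0" "m * (1 - s) \<le> b"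
      using True s abcd by (auto simp: m_def field_simps)
    have "z = (a + m * (1 - t)) *\<^sub>R A + (b - m * (1 - s)) *\<^sub>R B + (c + m * t) *\<^sub>R C"
    proof -
      have "z = a *\<^sub>R A + c *\<^sub>R C + (b *\<^sub>R B + d *\<^sub>R D)"
        by (simp add: z)
      then show ?thesis
        by (simp add: trade[of m] m(2) scaleR_add_left)
    qed
    moreover have "(a + m * (1 - t)) + (b - m * (1 - s)) + (c + m * t) = 1"
      using abcd(5) m(2) by (simp add: algebra_simps)
    moreover have "0 \<le> a + m * (1 - t)" "0 \<le> c + m * t" "0 \<le> b - m * (1 - s)"
      using abcd m t by auto
    ultimately show ?thesis
      unfolding convex_hull_3 by blast
  next
    case False
    define m where "m = b / (1 - s)"
    have m: "0 \<le> m" "b - m * (1 - s) = 0" "m * s \<le> d"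
      using False s abcd by (auto simp: m_def field_simps)
    have "z = (a + m * (1 - t)) *\<^sub>R A + (c + m * t) *\<^sub>R C + (d - m * s) *\<^sub>R D"
    proof -
      have "z = a *\<^sub>R A + c *\<^sub>R C + (b *\<^sub>R B + d *\<^sub>R D)"
        by (simp add: z)
      then show ?thesis
        by (simp add: trade[of m] m(2) scaleR_add_left)
    qed
    moreover have "(a + m * (1 - t)) + (c + m * t) + (d - m * s) = 1"
      using abcd(5) m(2) by (simp add: algebra_simps)
    moreover have "0 \<le> a + m * (1 - t)" "0 \<le> c + m * t" "0 \<le> d - m * s"
      using abcd m t by auto
    ultimately show ?thesis
      unfolding convex_hull_3 by blast
  qed
next
  fix z assume "z \<in> convex hull {A, B, C} \<union> convex hull {A, C, D}"
  moreover have "convex hull {A, B, C} \<subseteq> convex hull {A, B, C, D}"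
    "convex hull {A, C, D} \<subseteq> convex hull {A, B, C, D}"
    by (intro hull_mono; auto)+
  ultimately show "z \<in> convex hull {A, B, C, D}"
    by blast
qed

lemma measure_triangle_orient:
  "measure lebesgue (convex hull {A, B, C}) = \<bar>orient A B C\<bar> / 2"
proof -
  have "convex hull {A, B, C} \<in> sets borel"
    by (intro borel_compact finite_imp_compact_convex_hull) auto
  moreover have "\<bar>orient A B C\<bar>
      = \<bar>(C $ 1 - A $ 1) * (B $ 2 - A $ 2) - (B $ 1 - A $ 1) * (C $ 2 - A $ 2)\<bar>"
    unfolding orient_def by (simp add: abs_minus_commute mult.commute)
  ultimately show ?thesis
    by (simp add: content_triangle measure_completion)
qed

text \<open>
  The four signs say that each diagonal separates the other two vertices. The diagonals
  then meet, in ratios given by the signed areas, and the two triangles on either side of \<open>A C\<close>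
  overlap only within the line \<open>A C\<close>, a null set.
\<close>

lemma area_of_convex_quadrilateral:
  assumes pos: "0 < orient A B C" "0 < orient A C D" "0 < orient A B D" "0 < orient B C D"
  shows "quadrilateral_area A B C D = (orient A B C + orient A C D) / 2"
proof -
  define p q u v where pquv: "p = orient A B D" "q = orient B C D" "u = orient A B C" "v = orient A C D"
  have sum: "p + q = u + v"
    unfolding pquv orient_def by (simp add: algebra_simps)
  have pos': "0 < p" "0 < q" "0 < u" "0 < v"
    using pos by (simp_all add: pquv)
  \<comment> \<open>Barycentric identity for four points of the plane: both sides, divided by
    \<open>p + q = u + v\<close>, are the intersection point of the diagonals.\<close>
  have comb: "q *\<^sub>R A + p *\<^sub>R C = v *\<^sub>R B + u *\<^sub>R D"
    unfolding pquv orient_def vec_eq_iff forall_2 by (simp add: algebra_simps)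
  define t s where "t = p / (p + q)" and "s = u / (u + v)"
  have ts: "0 < t" "t < 1" "0 < s" "s < 1"
    using pos' by (auto simp: t_def s_def)
  have "1 - t = q / (p + q)" "1 - s = v / (u + v)"
    using pos' by (auto simp: t_def s_def field_simps)
  then have "(1 - t) *\<^sub>R A + t *\<^sub>R C = (1 / (p + q)) *\<^sub>R (q *\<^sub>R A + p *\<^sub>R C)"
    "(1 - s) *\<^sub>R B + s *\<^sub>R D = (1 / (u + v)) *\<^sub>R (v *\<^sub>R B + u *\<^sub>R D)"
    by (simp_all add: t_def s_def scaleR_add_right)
  then have X: "(1 - t) *\<^sub>R A + t *\<^sub>R C = (1 - s) *\<^sub>R B + s *\<^sub>R D"
    using comb sum by simp
  have split: "convex hull {A, B, C, D} = convex hull {A, B, C} \<union> convex hull {A, C, D}"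
    by (rule convex_hull_quadrilateral_split[OF X]) (use ts in auto)
  \<comment> \<open>A normal vector of the line \<open>A C\<close>, on whose two sides the triangles lie.\<close>
  define n :: "real^2" where "n = vector [-(C$2 - A$2), C$1 - A$1]"
  have n: "n \<bullet> z = (C$1 - A$1) * z$2 - (C$2 - A$2) * z$1" for z
    by (simp add: n_def inner_vec_def sum_2 algebra_simps)
  have hB: "orient A B C = n \<bullet> A - n \<bullet> B" and hD: "orient A C D = n \<bullet> D - n \<bullet> A"
    and hC: "n \<bullet> C = n \<bullet> A"
    unfolding n orient_def by (simp_all add: algebra_simps)
  have "n \<noteq> 0"
    using hB pos(1) by auto
  have "convex hull {A, B, C} \<subseteq> {z. n \<bullet> z \<le> n \<bullet> A}" "convex hull {A, C, D} \<subseteq> {z. n \<bullet> z \<ge> n \<bullet> A}"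
    using hB hC hD pos by (intro hull_minimal; auto simp: convex_halfspace_le convex_halfspace_ge)+
  then have "convex hull {A, B, C} \<inter> convex hull {A, C, D} \<subseteq> {z. n \<bullet> z = n \<bullet> A}"
    by force
  moreover have "negligible {z. n \<bullet> z = n \<bullet> A}"
    using \<open>n \<noteq> 0\<close> by (intro negligible_hyperplane) auto
  ultimately have null: "negligible (convex hull {A, B, C} \<inter> convex hull {A, C, D})"
    by (rule negligible_subset[rotated])
  have meas: "convex hull {A, B, C} \<in> lmeasurable" "convex hull {A, C, D} \<in> lmeasurable"
    by (intro lmeasurable_compact finite_imp_compact_convex_hull; simp)+
  have "quadrilateral_area A B C D
      = measure lebesgue (convex hull {A, B, C}) + measure lebesgue (convex hull {A, C, D})"
    unfolding quadrilateral_area_def split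
    using measure_Un3[OF meas] null by (simp add: negligible_imp_measure0)
  then show ?thesis
    using pos by (simp add: measure_triangle_orient field_simps)
qed
text \<open>
  On a circle two triangle orientations already determine the cyclic order of all four points, and
  with it the two orientations that convexity still requires.
\<close>

lemma cyclic_quadrilateral_if_oriented:
  assumes sph: "{A, B, C, D} \<subseteq> sphere c r" and r: "0 < r"
    and pos: "0 < orient A B C" "0 < orient A C D"
  shows "cyclic_quadrilateral A B C D"
    and "quadrilateral_area A B C D = (orient A B C + orient A C D) / 2"
proof -
  obtain a where A: "A = circle_point c r a"
    using sphere_point_is_circle_point[of A c r] sph r by blast
  obtain b where b: "a \<le> b" "b < a + 2 * pi" and B: "B = circle_point c r b"
    using sphere_point_is_circle_point[of B c r a] sph r by blast
  obtain g where g: "a \<le> g" "g < a + 2 * pi" and C: "C = circle_point c r g"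
    using sphere_point_is_circle_point[of C c r a] sph r by blast
  obtain d where d: "a \<le> d" "d < a + 2 * pi" and D: "D = circle_point c r d"
    using sphere_point_is_circle_point[of D c r a] sph r by blast
  have ord: "a < b" "b < g" "g < d"
    using pos r b g d by (simp_all add: A B C D orient_circle_point_pos_iff)
  have pos': "0 < orient A B D" "0 < orient B C D"
    using r b g d ord by (simp_all add: A B C D orient_circle_point_pos_iff)
  have "ccw_on_circle c r A B C D"
    unfolding ccw_on_circle_def using ord d A B C D by blast
  moreover have "distinct [A, B, C, D]"
    using pos pos' by (auto simp: orient_def)
  ultimately show "cyclic_quadrilateral A B C D"
    unfolding cyclic_quadrilateral_def using sph r by blast
  show "quadrilateral_area A B C D = (orient A B C + orient A C D) / 2"
    by (rule area_of_convex_quadrilateral[OF pos pos'])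
qed

section \<open>The quadratic equation for the fourth vertex\<close>

text \<open>
  Coordinates are centred at \<open>C\<close>, with \<open>D = (0, -d)\<close> and the compact set inside the square of half
  side \<open>M\<close> around \<open>(R, 0)\<close>. Write \<open>A = (x, y)\<close> and \<open>B = (x + p, y + q)\<close>. The quadrilateral
  \<open>D A B C\<close> has area \<open>1\<close> iff \<open>x q - y p = 2 - d x\<close>, and \<open>B\<close> lies on the circle through \<open>A, C, D\<close>
  iff \<open>u \<mapsto> (u\<^sub>1\<^sup>2 + u\<^sub>2\<^sup>2 + d u\<^sub>2) / u\<^sub>1\<close> takes the same value at \<open>A\<close> and \<open>B\<close>. The predicate
  \<open>far_box\<close> collects the standing assumptions on these quantities; the factor \<open>200\<close> is a
  convenient choice of ``much larger''.
\<close>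

definition far_box :: "real \<Rightarrow> real \<Rightarrow> real \<Rightarrow> real \<Rightarrow> real \<Rightarrow> bool" where
  "far_box M R d x y \<longleftrightarrow>
    1 \<le> M \<and> 200 * M \<le> R \<and> \<bar>x - R\<bar> \<le> M \<and> \<bar>y\<bar> \<le> M \<and> 0 < d \<and> 4 * d * R \<le> 1"

text \<open>
  Substituting \<open>x q = 2 - d x + y p\<close> into the circle condition, multiplied by \<open>x\<close>, leaves the equation
  \<open>coeff2 p\<^sup>2 + coeff1 p + coeff0 = 0\<close> for the horizontal displacement \<open>p\<close>. For large \<open>R\<close> the
  coefficients have orders \<open>R\<^sup>2\<close>, \<open>R\<^sup>3\<close> and \<open>R M\<close>; hence one root is small and depends on \<open>(x, y)\<close>
  almost like \<open>- coeff0 / coeff1\<close>.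
\<close>

definition coeff2 :: "real \<Rightarrow> real \<Rightarrow> real" where
  "coeff2 x y = x\<^sup>2 + y\<^sup>2"

definition coeff1 :: "real \<Rightarrow> real \<Rightarrow> real \<Rightarrow> real" where
  "coeff1 d x y = x * coeff2 x y + 2 * y * (2 - d * x)"

definition coeff0 :: "real \<Rightarrow> real \<Rightarrow> real \<Rightarrow> real" where
  "coeff0 d x y = 2 * (2 - d * x) * (x * y + 1)"

lemma far_box_bounds:
  assumes "far_box M R d x y"
  shows "200 \<le> R" "9 / 10 * R \<le> x" "x \<le> 11 / 10 * R" "\<bar>y\<bar> \<le> R / 200"
    "0 < d" "d * R \<le> 1 / 4" "0 \<le> d * x" "d * x \<le> 1"
proof -
  have M: "1 \<le> M" and R: "200 * M \<le> R" and x: "\<bar>x - R\<bar> \<le> M" and y: "\<bar>y\<bar> \<le> M"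
    and d: "0 < d" "4 * d * R \<le> 1"
    using assms by (simp_all add: far_box_def)
  show "200 \<le> R" and xb: "9 / 10 * R \<le> x" "x \<le> 11 / 10 * R" and "\<bar>y\<bar> \<le> R / 200"
    using M R x y by linarith+
  show "0 < d" and dR: "d * R \<le> 1 / 4"
    using d by auto
  have "d * x \<le> d * (11 / 10 * R)"
    using d xb by (intro mult_left_mono) auto
  then show "d * x \<le> 1"
    using dR by linarith
  show "0 \<le> d * x"
    using d xb \<open>200 \<le> R\<close> by auto
qed

text \<open>
  The bound \<open>R\<^sup>2 / 20\<close> for \<open>coeff0\<close> is crude. It suffices that at \<open>p = 1 / R\<close> and \<open>p = - 1 / R\<close> the linear
  term dominates the constant one.
\<close>

lemma coeff_bounds:
  assumes "far_box M R d x y"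
  shows "0 \<le> coeff2 x y" "coeff2 x y \<le> 3 * (R * R)"
    and "6 / 10 * (R * (R * R)) \<le> coeff1 d x y"
    and "\<bar>coeff0 d x y\<bar> \<le> 1 / 20 * (R * R)"
proof -
  note b = far_box_bounds[OF assms]
  have R0: "0 < R" and x0: "0 < x"
    using b(1,2) by linarith+
  have x2: "x * x \<le> 11 / 10 * R * (11 / 10 * R)" "9 / 10 * R * (9 / 10 * R) \<le> x * x"
    using b x0 R0 by (intro mult_mono; simp)+
  have "\<bar>y\<bar> * \<bar>y\<bar> \<le> R * R"
    using b R0 by (intro mult_mono) auto
  then have y2: "y * y \<le> R * R"
    by simp
  have y20: "0 \<le> y * y"
    by simp
  have a2: "coeff2 x y = x * x + y * y"
    by (simp add: coeff2_def power2_eq_square)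
  have RR: "200 * R \<le> R * R" "40000 \<le> R * R"
    using b(1) mult_mono[of 200 R 200 R] by auto
  have R3: "40000 * R \<le> R * (R * R)"
    using mult_left_mono[OF RR(2), of R] R0 by simp
  have RRx: "11 / 10 * R * (11 / 10 * R) = 121 / 100 * (R * R)"
    "9 / 10 * R * (9 / 10 * R) = 81 / 100 * (R * R)"
    by simp_all
  show "0 \<le> coeff2 x y"
    by (simp add: coeff2_def)
  show "coeff2 x y \<le> 3 * (R * R)"
    using x2 y2 RRx a2 RR(2) by linarith
  have "81 / 100 * (R * R) \<le> coeff2 x y"
    using x2 y20 RRx a2 by linarith
  then have "9 / 10 * R * (81 / 100 * (R * R)) \<le> x * coeff2 x y"
    using b R0 x0 by (intro mult_mono) auto
  then have xa: "729 / 1000 * (R * (R * R)) \<le> x * coeff2 x y"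
    by simp
  have "\<bar>2 * y\<bar> * \<bar>2 - d * x\<bar> \<le> (2 * R) * 2"
    using b R0 by (intro mult_mono) auto
  then have "\<bar>2 * y * (2 - d * x)\<bar> \<le> 4 * R"
    by (simp add: abs_mult)
  then have "- (4 * R) \<le> 2 * y * (2 - d * x)"
    by linarith
  then show "6 / 10 * (R * (R * R)) \<le> coeff1 d x y"
    unfolding coeff1_def using xa R3 R0 by linarith
  have "x * \<bar>y\<bar> \<le> 11 / 10 * R * (R / 200)"
    using b R0 x0 by (intro mult_mono) auto
  then have "\<bar>x * y\<bar> \<le> 11 / 2000 * (R * R)"
    using x0 by (simp add: abs_mult)
  then have "\<bar>x * y + 1\<bar> \<le> 11 / 2000 * (R * R) + 1"
    by linarith
  then have "\<bar>2 * (2 - d * x)\<bar> * \<bar>x * y + 1\<bar> \<le> 4 * (11 / 2000 * (R * R) + 1)"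
    using b by (intro mult_mono) auto
  also have "\<dots> = 11 / 500 * (R * R) + 4"
    by simp
  also have "\<dots> \<le> 1 / 20 * (R * R)"
    using RR(2) by linarith
  finally show "\<bar>coeff0 d x y\<bar> \<le> 1 / 20 * (R * R)"
    unfolding coeff0_def abs_mult[of "2 * (2 - d * x)"] .
qed

lemma small_root_exists:
  assumes "far_box M R d x y"
  shows "\<exists>p. \<bar>p\<bar> * R \<le> 1 \<and> coeff2 x y * p\<^sup>2 + coeff1 d x y * p + coeff0 d x y = 0"
proof -
  let ?g = "\<lambda>p. coeff2 x y * p\<^sup>2 + coeff1 d x y * p + coeff0 d x y"
  note b = far_box_bounds[OF assms] and c = coeff_bounds[OF assms]
  have R0: "0 < R"
    using b(1) by linarith
  have "40000 \<le> R * R"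
    using b(1) mult_mono[of 200 R 200 R] by auto
  have c1: "6 / 10 * (R * R) \<le> coeff1 d x y / R"
    using c(3) R0 by (simp add: field_simps)
  have c2: "0 \<le> coeff2 x y * (1 / R)\<^sup>2" "coeff2 x y * (1 / R)\<^sup>2 \<le> 3"
    using c R0 by (auto simp: power2_eq_square field_simps)
  have neg: "?g (- (1 / R)) = coeff2 x y * (1 / R)\<^sup>2 - coeff1 d x y / R + coeff0 d x y"
    and pos: "?g (1 / R) = coeff2 x y * (1 / R)\<^sup>2 + coeff1 d x y / R + coeff0 d x y"
    by simp_all
  have "\<exists>p\<ge>- (1 / R). p \<le> 1 / R \<and> ?g p = 0"
  proof (intro IVT')
    show "?g (- (1 / R)) \<le> 0" "0 \<le> ?g (1 / R)"
      unfolding neg pos using c1 c2 c(4) \<open>40000 \<le> R * R\<close> by linarith+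
    show "- (1 / R) \<le> 1 / R"
      using R0 by simp
    show "continuous_on {- (1 / R)..1 / R} ?g"
      by (intro continuous_intros)
  qed
  then obtain p where "\<bar>p\<bar> \<le> 1 / R" "?g p = 0"
    by (metis abs_le_iff minus_le_iff)
  then show ?thesis
    using R0 by (intro exI[of _ p]) (simp add: field_simps)
qed

text \<open>
  Up to constants, each coefficient varies at the rate suggested by its degree in \<open>R\<close>: the terms that
  carry \<open>d\<close> stay harmless because \<open>d R \<le> 1 / 4\<close>.
\<close>

lemma coeff_lipschitz:
  assumes box: "far_box M R d x y" "far_box M R d x' y'"
  defines "\<delta> \<equiv> \<bar>x - x'\<bar> + \<bar>y - y'\<bar>"
  shows "\<bar>coeff2 x y - coeff2 x' y'\<bar> \<le> 3 * (R * \<delta>)"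
    and "\<bar>coeff1 d x y - coeff1 d x' y'\<bar> \<le> 8 * (R * (R * \<delta>))"
    and "\<bar>coeff0 d x y - coeff0 d x' y'\<bar> \<le> 6 * (R * \<delta>)"
proof -
  note b = far_box_bounds[OF box(1)] and b' = far_box_bounds[OF box(2)]
  have R0: "0 < R" "0 < x" "0 < x'"
    using b b' by linarith+
  have \<delta>: "0 \<le> \<delta>" "\<bar>x - x'\<bar> \<le> \<delta>" "\<bar>y - y'\<bar> \<le> \<delta>"
    by (simp_all add: \<delta>_def)
  have R\<delta>: "200 * \<delta> \<le> R * \<delta>"
    using b(1) \<delta> by (intro mult_right_mono) auto
  have RR\<delta>: "200 * (R * \<delta>) \<le> R * (R * \<delta>)"
    using b(1) \<delta> R0 by (intro mult_right_mono) auto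
  have e2: "coeff2 x y - coeff2 x' y' = (x + x') * (x - x') + (y + y') * (y - y')"
    by (simp add: coeff2_def power2_eq_square algebra_simps)
  have "\<bar>x + x'\<bar> * \<bar>x - x'\<bar> \<le> (22 / 10 * R) * \<delta>" "\<bar>y + y'\<bar> * \<bar>y - y'\<bar> \<le> (1 / 100 * R) * \<delta>"
    using b b' R0 \<delta> by (intro mult_mono; linarith)+
  then have "\<bar>(x + x') * (x - x')\<bar> \<le> 22 / 10 * (R * \<delta>)" "\<bar>(y + y') * (y - y')\<bar> \<le> 1 / 100 * (R * \<delta>)"
    by (simp_all add: abs_mult)
  then show c2: "\<bar>coeff2 x y - coeff2 x' y'\<bar> \<le> 3 * (R * \<delta>)"
    unfolding e2 using R\<delta> \<delta> by linarith
  have xy: "\<bar>x * y - x' * y'\<bar> \<le> 12 / 10 * (R * \<delta>)"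
  proof -
    have "\<bar>x\<bar> * \<bar>y - y'\<bar> \<le> (11 / 10 * R) * \<delta>" "\<bar>y'\<bar> * \<bar>x - x'\<bar> \<le> (1 / 200 * R) * \<delta>"
      using b b' R0 \<delta> by (intro mult_mono; linarith)+
    then have "\<bar>x * (y - y')\<bar> \<le> 11 / 10 * (R * \<delta>)" "\<bar>y' * (x - x')\<bar> \<le> 1 / 200 * (R * \<delta>)"
      by (simp_all add: abs_mult)
    moreover have "x * y - x' * y' = x * (y - y') + y' * (x - x')"
      by (simp add: algebra_simps)
    ultimately show ?thesis
      using R\<delta> \<delta> by linarith
  qed
  have dxy: "\<bar>d * (x * y - x' * y')\<bar> \<le> \<delta>"
  proof -
    have "d * \<bar>x * y - x' * y'\<bar> \<le> d * (12 / 10 * (R * \<delta>))"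
      using xy b(5) by (intro mult_left_mono) auto
    also have "\<dots> = 12 / 10 * ((d * R) * \<delta>)"
      by simp
    also have "(d * R) * \<delta> \<le> 1 / 4 * \<delta>"
      using b(6) \<delta> by (intro mult_right_mono) auto
    finally show ?thesis
      using b(5) \<delta> by (simp add: abs_mult)
  qed
  have "\<bar>x - x'\<bar> * coeff2 x y \<le> \<delta> * (3 * (R * R))"
    "x' * \<bar>coeff2 x y - coeff2 x' y'\<bar> \<le> 11 / 10 * R * (3 * (R * \<delta>))"
    using coeff_bounds[OF box(1)] \<delta> R0 b' c2 by (intro mult_mono; simp)+
  then have s12: "\<bar>(x - x') * coeff2 x y\<bar> \<le> 3 * (R * (R * \<delta>))"
    "\<bar>x' * (coeff2 x y - coeff2 x' y')\<bar> \<le> 33 / 10 * (R * (R * \<delta>))"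
    using coeff_bounds(1)[OF box(1)] R0 by (simp_all add: abs_mult mult_ac)
  have e1: "coeff1 d x y - coeff1 d x' y' = (x - x') * coeff2 x y
      + x' * (coeff2 x y - coeff2 x' y') + 4 * (y - y') - 2 * (d * (x * y - x' * y'))"
    by (simp add: coeff1_def algebra_simps)
  have "\<bar>s + t + 4 * u - 2 * v\<bar> \<le> \<bar>s\<bar> + \<bar>t\<bar> + 4 * \<bar>u\<bar> + 2 * \<bar>v\<bar>" for s t u v :: real
    by linarith
  then have "\<bar>coeff1 d x y - coeff1 d x' y'\<bar> \<le> \<bar>(x - x') * coeff2 x y\<bar>
      + \<bar>x' * (coeff2 x y - coeff2 x' y')\<bar> + 4 * \<bar>y - y'\<bar> + 2 * \<bar>d * (x * y - x' * y')\<bar>"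
    unfolding e1 .
  also have "\<dots> \<le> 3 * (R * (R * \<delta>)) + 33 / 10 * (R * (R * \<delta>)) + 4 * \<delta> + 2 * \<delta>"
    using s12 dxy \<delta> by (intro add_mono mult_left_mono) auto
  also have "\<dots> \<le> 8 * (R * (R * \<delta>))"
    using \<delta> R\<delta> RR\<delta> by linarith
  finally show "\<bar>coeff1 d x y - coeff1 d x' y'\<bar> \<le> 8 * (R * (R * \<delta>))" .
  have "\<bar>2 * (2 - d * x)\<bar> * \<bar>x * y - x' * y'\<bar> \<le> 4 * (12 / 10 * (R * \<delta>))"
    using b xy \<delta> R0 by (intro mult_mono) auto
  then have t1: "\<bar>2 * (2 - d * x) * (x * y - x' * y')\<bar> \<le> 48 / 10 * (R * \<delta>)"
    unfolding abs_mult[of "2 * (2 - d * x)"] by simp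
  have "x' * \<bar>y'\<bar> \<le> 11 / 10 * R * (R / 200)"
    using b b' R0 by (intro mult_mono) auto
  then have "\<bar>x' * y'\<bar> \<le> 11 / 2000 * (R * R)"
    using R0 by (simp add: abs_mult)
  moreover have "40000 \<le> R * R"
    using b(1) mult_mono[of 200 R 200 R] by auto
  ultimately have "\<bar>x' * y' + 1\<bar> \<le> 1 / 10 * (R * R)"
    by linarith
  then have "d * \<bar>x' * y' + 1\<bar> \<le> d * (1 / 10 * (R * R))"
    using b(5) by (intro mult_left_mono) auto
  also have "\<dots> = 1 / 10 * R * (d * R)"
    by simp
  also have "\<dots> \<le> 1 / 10 * R * (1 / 4)"
    using b(6) R0 by (intro mult_left_mono) auto
  finally have dxy1: "d * \<bar>x' * y' + 1\<bar> \<le> 1 / 10 * R * (1 / 4)" .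
  have "\<bar>x - x'\<bar> * (d * \<bar>x' * y' + 1\<bar>) \<le> \<delta> * (1 / 10 * R * (1 / 4))"
    by (rule mult_mono[OF \<delta>(2) dxy1]) (use \<delta> b(5) in auto)
  then have t2: "\<bar>(x - x') * (d * (x' * y' + 1))\<bar> \<le> 1 / 40 * (R * \<delta>)"
    using b(5) by (simp add: abs_mult mult_ac)
  have "coeff0 d x y - coeff0 d x' y'
      = 2 * (2 - d * x) * (x * y - x' * y') - 2 * ((x - x') * (d * (x' * y' + 1)))"
    by (simp add: coeff0_def algebra_simps)
  then show "\<bar>coeff0 d x y - coeff0 d x' y'\<bar> \<le> 6 * (R * \<delta>)"
    using t1 t2 R\<delta> \<delta> by linarith
qed

text \<open>
  Subtracting the two quadratic equations gives \<open>F (p - p') = - T\<close>, where \<open>F\<close> is dominated by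
  \<open>coeff1\<close> and so of order \<open>R\<^sup>3\<close>, while \<open>T\<close>, the effect of changing the coefficients, is of order
  \<open>R\<close> times the distance of the two points. This comparison of equations spares differentiating the
  root.
\<close>

lemma small_root_lipschitz:
  assumes box: "far_box M R d x y" "far_box M R d x' y'"
    and p: "\<bar>p\<bar> * R \<le> 1" "coeff2 x y * p\<^sup>2 + coeff1 d x y * p + coeff0 d x y = 0"
    and p': "\<bar>p'\<bar> * R \<le> 1" "coeff2 x' y' * p'\<^sup>2 + coeff1 d x' y' * p' + coeff0 d x' y' = 0"
  shows "R * R * \<bar>p - p'\<bar> \<le> 40 * (\<bar>x - x'\<bar> + \<bar>y - y'\<bar>)"
proof -
  define \<delta> where "\<delta> = \<bar>x - x'\<bar> + \<bar>y - y'\<bar>"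
  note b = far_box_bounds[OF box(1)] and c = coeff_bounds[OF box(1)]
  note l = coeff_lipschitz[OF box, folded \<delta>_def]
  have R0: "0 < R" and \<delta>: "0 \<le> \<delta>"
    using b(1) by (auto simp: \<delta>_def)
  have R\<delta>: "200 * \<delta> \<le> R * \<delta>"
    using b(1) \<delta> by (intro mult_right_mono) auto
  have RR: "40000 \<le> R * R"
    using b(1) mult_mono[of 200 R 200 R] by auto
  define F where "F = coeff2 x y * (p + p') + coeff1 d x y"
  define T where "T = (coeff2 x y - coeff2 x' y') * p'\<^sup>2 + (coeff1 d x y - coeff1 d x' y') * p'
      + (coeff0 d x y - coeff0 d x' y')"
  have FT: "F * (p - p') = - T"
    using p(2) p'(2) unfolding F_def T_def by (simp add: algebra_simps power2_eq_square)
  have F: "1 / 2 * (R * (R * R)) \<le> F"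
  proof -
    have "\<bar>p + p'\<bar> * R \<le> (\<bar>p\<bar> + \<bar>p'\<bar>) * R"
      using R0 by (intro mult_right_mono) auto
    then have pp: "\<bar>p + p'\<bar> * R \<le> 2"
      using p(1) p'(1) by (simp add: distrib_right)
    have "coeff2 x y * \<bar>p + p'\<bar> \<le> 3 * (R * R) * \<bar>p + p'\<bar>"
      using c by (intro mult_right_mono) auto
    also have "\<dots> = 3 * R * (\<bar>p + p'\<bar> * R)"
      by simp
    also have "\<dots> \<le> 3 * R * 2"
      using pp R0 by (intro mult_left_mono) auto
    finally have "\<bar>coeff2 x y * (p + p')\<bar> \<le> 6 * R"
      using c(1) by (simp add: abs_mult)
    moreover have "40000 * R \<le> R * (R * R)"
      using mult_left_mono[OF RR, of R] R0 by simp
    ultimately show ?thesis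
      using c(3) R0 unfolding F_def by linarith
  qed
  have T: "\<bar>T\<bar> \<le> 20 * (R * \<delta>)"
  proof -
    have p'1: "\<bar>p'\<bar> \<le> 1"
      using p'(1) b(1) mult_left_mono[of 1 R "\<bar>p'\<bar>"] by auto
    then have "\<bar>coeff2 x y - coeff2 x' y'\<bar> * \<bar>p'\<bar>\<^sup>2 \<le> 3 * (R * \<delta>) * 1"
      using l(1) R0 \<delta> by (intro mult_mono) (auto simp: abs_square_le_1)
    then have 1: "\<bar>(coeff2 x y - coeff2 x' y') * p'\<^sup>2\<bar> \<le> 3 * (R * \<delta>)"
      by (simp add: abs_mult)
    have "\<bar>coeff1 d x y - coeff1 d x' y'\<bar> * \<bar>p'\<bar> \<le> 8 * (R * (R * \<delta>)) * \<bar>p'\<bar>"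
      using l(2) by (intro mult_right_mono) auto
    also have "\<dots> = 8 * (R * \<delta>) * (\<bar>p'\<bar> * R)"
      by simp
    also have "\<dots> \<le> 8 * (R * \<delta>) * 1"
      using p'(1) R0 \<delta> by (intro mult_left_mono) auto
    finally have 2: "\<bar>(coeff1 d x y - coeff1 d x' y') * p'\<bar> \<le> 8 * (R * \<delta>)"
      by (simp add: abs_mult)
    have "0 \<le> R * \<delta>"
      using R0 \<delta> by simp
    with 1 2 l(3) show ?thesis
      unfolding T_def by linarith
  qed
  have "1 / 2 * (R * (R * R)) * \<bar>p - p'\<bar> \<le> F * \<bar>p - p'\<bar>"
    using F by (intro mult_right_mono) auto
  also have "\<dots> = \<bar>T\<bar>"
  proof -
    have "0 \<le> F"
      using R0 by (intro order_trans[OF _ F]) simp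
    then have "F * \<bar>p - p'\<bar> = \<bar>F * (p - p')\<bar>"
      by (simp add: abs_mult)
    then show ?thesis
      using FT by simp
  qed
  finally have "R * (R * R * \<bar>p - p'\<bar>) \<le> R * (40 * \<delta>)"
    using T by simp
  then show ?thesis
    using R0 by (simp add: \<delta>_def)
qed

text \<open>
  The displacement \<open>(p, q)\<close> from \<open>A\<close> to \<open>B\<close> as a function of the position of \<open>A\<close>. The vertical part is
  \<open>q = (2 - d x + y p) / x\<close>, so its bounds follow from those for \<open>p\<close>. The
  constant \<open>1 / 4\<close> keeps \<open>A \<mapsto> B\<close> from shrinking any distance by more than one half.
\<close>

lemma unit_area_displacement:
  assumes M: "1 \<le> M" "200 * M \<le> R" and d: "0 < d" "4 * d * R \<le> 1"
  obtains p q :: "real \<Rightarrow> real \<Rightarrow> real" where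
    "\<And>x y. \<lbrakk>\<bar>x - R\<bar> \<le> M; \<bar>y\<bar> \<le> M\<rbrakk> \<Longrightarrow> 2 - d * x + y * p x y = x * q x y"
    "\<And>x y. \<lbrakk>\<bar>x - R\<bar> \<le> M; \<bar>y\<bar> \<le> M\<rbrakk> \<Longrightarrow>
        ((x + p x y)\<^sup>2 + (y + q x y)\<^sup>2 + d * (y + q x y)) * x = (x\<^sup>2 + y\<^sup>2 + d * y) * (x + p x y)"
    "\<And>x y. \<lbrakk>\<bar>x - R\<bar> \<le> M; \<bar>y\<bar> \<le> M\<rbrakk> \<Longrightarrow> \<bar>p x y\<bar> + \<bar>q x y\<bar> \<le> 4 / R"
    "\<And>x y x' y'. \<lbrakk>\<bar>x - R\<bar> \<le> M; \<bar>y\<bar> \<le> M; \<bar>x' - R\<bar> \<le> M; \<bar>y'\<bar> \<le> M\<rbrakk> \<Longrightarrow>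
        \<bar>p x y - p x' y'\<bar> + \<bar>q x y - q x' y'\<bar> \<le> 1 / 4 * (\<bar>x - x'\<bar> + \<bar>y - y'\<bar>)"
proof -
  have box: "far_box M R d x y \<longleftrightarrow> \<bar>x - R\<bar> \<le> M \<and> \<bar>y\<bar> \<le> M" for x y
    using M d by (simp add: far_box_def)
  obtain p where p: "\<And>x y. far_box M R d x y \<Longrightarrow> \<bar>p x y\<bar> * R \<le> 1"
      "\<And>x y. far_box M R d x y \<Longrightarrow>
        coeff2 x y * (p x y)\<^sup>2 + coeff1 d x y * p x y + coeff0 d x y = 0"
    using small_root_exists by metis
  define q where "q x y = (2 - d * x + y * p x y) / x" for x y
  have R0: "200 \<le> R" "0 < R"
    using M by auto
  have RR: "40000 \<le> R * R"
    using R0 mult_mono[of 200 R 200 R] by auto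
  have xpos: "0 < x" if "far_box M R d x y" for x y
    using far_box_bounds[OF that] by linarith
  have xq: "x * q x y = 2 - d * x + y * p x y" if "far_box M R d x y" for x y
    using xpos[OF that] by (simp add: q_def)
  have yp: "\<bar>y * p x y\<bar> \<le> 1 / 200" if "far_box M R d x y" for x y
  proof -
    have "\<bar>y\<bar> * \<bar>p x y\<bar> \<le> R / 200 * \<bar>p x y\<bar>"
      using far_box_bounds(4)[OF that] by (intro mult_right_mono) auto
    then show ?thesis
      using p(1)[OF that] by (simp add: abs_mult mult_ac)
  qed
  have Rq: "R * \<bar>q x y\<bar> \<le> 3" if B: "far_box M R d x y" for x y
  proof -
    note b = far_box_bounds[OF B]
    have "\<bar>x * q x y\<bar> \<le> 5 / 2"
      using xq[OF B] yp[OF B] b(7,8) by linarith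
    then have "x * \<bar>q x y\<bar> \<le> 5 / 2"
      using xpos[OF B] by (simp add: abs_mult)
    moreover have "9 / 10 * R * \<bar>q x y\<bar> \<le> x * \<bar>q x y\<bar>"
      using b(2) by (intro mult_right_mono) auto
    ultimately show ?thesis
      by linarith
  qed
  show thesis
  proof (rule that[of p q])
    fix x y assume "\<bar>x - R\<bar> \<le> M" "\<bar>y\<bar> \<le> M"
    then have B: "far_box M R d x y"
      by (simp add: box)
    note b = far_box_bounds[OF B]
    show "2 - d * x + y * p x y = x * q x y"
      using xq[OF B] by simp
    let ?p = "p x y" and ?q = "q x y"
    have "x * (((x + ?p)\<^sup>2 + (y + ?q)\<^sup>2 + d * (y + ?q)) * x - (x\<^sup>2 + y\<^sup>2 + d * y) * (x + ?p))
        = x * ?p * (x\<^sup>2 - y\<^sup>2 - d * y + x * ?p) + (x * ?q) * (2 * (x * y) + x * ?q + d * x)"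
      by (simp add: algebra_simps power2_eq_square)
    also have "\<dots> = coeff2 x y * ?p\<^sup>2 + coeff1 d x y * ?p + coeff0 d x y"
      unfolding xq[OF B] coeff2_def coeff1_def coeff0_def by (simp add: algebra_simps power2_eq_square)
    also have "\<dots> = 0"
      by (rule p(2)[OF B])
    finally have "((x + ?p)\<^sup>2 + (y + ?q)\<^sup>2 + d * (y + ?q)) * x - (x\<^sup>2 + y\<^sup>2 + d * y) * (x + ?p) = 0"
      using xpos[OF B] by simp
    then show "((x + ?p)\<^sup>2 + (y + ?q)\<^sup>2 + d * (y + ?q)) * x = (x\<^sup>2 + y\<^sup>2 + d * y) * (x + ?p)"
      by simp
    have "R * (\<bar>?p\<bar> + \<bar>?q\<bar>) \<le> 4"
      using p(1)[OF B] Rq[OF B] by (simp add: algebra_simps)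
    then show "\<bar>?p\<bar> + \<bar>?q\<bar> \<le> 4 / R"
      using R0 by (simp add: field_simps)
  next
    fix x y x' y' assume "\<bar>x - R\<bar> \<le> M" "\<bar>y\<bar> \<le> M" "\<bar>x' - R\<bar> \<le> M" "\<bar>y'\<bar> \<le> M"
    then have B: "far_box M R d x y" and B': "far_box M R d x' y'"
      by (simp_all add: box)
    note b = far_box_bounds[OF B] and b' = far_box_bounds[OF B']
    define \<delta> where "\<delta> = \<bar>x - x'\<bar> + \<bar>y - y'\<bar>"
    let ?p = "p x y" and ?q = "q x y" and ?p' = "p x' y'" and ?q' = "q x' y'"
    have \<delta>: "0 \<le> \<delta>" "\<bar>x - x'\<bar> \<le> \<delta>" "\<bar>y - y'\<bar> \<le> \<delta>"
      by (simp_all add: \<delta>_def)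
    have pp: "R * R * \<bar>?p - ?p'\<bar> \<le> 40 * \<delta>"
      unfolding \<delta>_def by (rule small_root_lipschitz[OF B B' p[OF B] p[OF B']])
    have Rdx: "R * \<bar>d * (x - x')\<bar> \<le> 1 / 4 * \<delta>"
    proof -
      have "d * R * \<bar>x - x'\<bar> \<le> 1 / 4 * \<delta>"
        by (rule mult_mono) (use b(6) \<delta> in auto)
      then show ?thesis
        using d by (simp add: abs_mult mult_ac)
    qed
    have Ryp: "R * \<bar>(y - y') * ?p\<bar> \<le> \<delta>"
    proof -
      have "(\<bar>?p\<bar> * R) * \<bar>y - y'\<bar> \<le> 1 * \<delta>"
        by (rule mult_mono) (use p(1)[OF B] \<delta> in auto)
      then show ?thesis
        by (simp add: abs_mult mult_ac)
    qed
    have Rpp: "R * \<bar>y' * (?p - ?p')\<bar> \<le> 1 / 5 * \<delta>"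
    proof -
      have "R * \<bar>y'\<bar> * \<bar>?p - ?p'\<bar> \<le> R * (R / 200) * \<bar>?p - ?p'\<bar>"
        using b'(4) R0 by (intro mult_right_mono mult_left_mono) auto
      then show ?thesis
        using pp by (simp add: abs_mult mult_ac)
    qed
    have Rqx: "R * \<bar>?q' * (x - x')\<bar> \<le> 3 * \<delta>"
    proof -
      have "(R * \<bar>?q'\<bar>) * \<bar>x - x'\<bar> \<le> 3 * \<delta>"
        by (rule mult_mono) (use Rq[OF B'] \<delta> in auto)
      then show ?thesis
        by (simp add: abs_mult mult_ac)
    qed
    \<comment> \<open>It is easier to compare \<open>x q\<close> than \<open>q\<close>, since \<open>x q\<close> is a polynomial in \<open>x\<close>, \<open>y\<close> and \<open>p\<close>.\<close>
    have "x * (?q - ?q') = x * ?q - x' * ?q' - ?q' * (x - x')"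
      by (simp add: algebra_simps)
    also have "\<dots> = (y - y') * ?p + y' * (?p - ?p') - d * (x - x') - ?q' * (x - x')"
      unfolding xq[OF B] xq[OF B'] by (simp add: algebra_simps)
    finally have xqq: "x * (?q - ?q') = (y - y') * ?p + y' * (?p - ?p') - d * (x - x') - ?q' * (x - x')" .
    have tri: "\<bar>s + t - u - v\<bar> \<le> \<bar>s\<bar> + \<bar>t\<bar> + \<bar>u\<bar> + \<bar>v\<bar>" for s t u v :: real
      by linarith
    have "9 / 10 * R * \<bar>?q - ?q'\<bar> \<le> x * \<bar>?q - ?q'\<bar>"
      using b(2) by (intro mult_right_mono) auto
    also have "\<dots> = \<bar>x * (?q - ?q')\<bar>"
      using xpos[OF B] by (simp add: abs_mult)
    also have "\<dots> \<le> \<bar>(y - y') * ?p\<bar> + \<bar>y' * (?p - ?p')\<bar> + \<bar>d * (x - x')\<bar> + \<bar>?q' * (x - x')\<bar>"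
      unfolding xqq by (rule tri)
    finally have "R * (9 / 10 * R * \<bar>?q - ?q'\<bar>)
        \<le> R * (\<bar>(y - y') * ?p\<bar> + \<bar>y' * (?p - ?p')\<bar> + \<bar>d * (x - x')\<bar> + \<bar>?q' * (x - x')\<bar>)"
      using R0 by (intro mult_left_mono) auto
    also have "\<dots> \<le> \<delta> + 1 / 5 * \<delta> + 1 / 4 * \<delta> + 3 * \<delta>"
      unfolding distrib_left using Rdx Ryp Rpp Rqx by (intro add_mono)
    finally have "R * R * \<bar>?q - ?q'\<bar> \<le> 5 * \<delta>"
      using \<delta>(1) by simp
    define w where "w = \<bar>?p - ?p'\<bar> + \<bar>?q - ?q'\<bar>"
    have "40000 * w \<le> R * R * w"
      using RR by (intro mult_right_mono) (auto simp: w_def)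
    also have "\<dots> \<le> 45 * \<delta>"
      unfolding w_def distrib_left using pp \<open>R * R * \<bar>?q - ?q'\<bar> \<le> 5 * \<delta>\<close> by simp
    finally have "w \<le> 1 / 4 * \<delta>"
      using \<delta>(1) by simp
    then show "\<bar>?p - ?p'\<bar> + \<bar>?q - ?q'\<bar> \<le> 1 / 4 * (\<bar>x - x'\<bar> + \<bar>y - y'\<bar>)"
      unfolding w_def \<delta>_def .
  qed
qed

section \<open>Orthonormal frames\<close>

definition rot90 :: "real^2 \<Rightarrow> real^2" where
  "rot90 u = vector [- u$2, u$1]"

lemma rot90_component [simp]: "rot90 u $ 1 = - u$2" "rot90 u $ 2 = u$1"
  by (simp_all add: rot90_def)

lemma rot90_diff: "rot90 (u - v) = rot90 u - rot90 v"
  by (simp add: vec_eq_iff forall_2)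

lemma inner_rot90 [simp]: "u \<bullet> rot90 u = 0" "rot90 u \<bullet> u = 0"
  by (simp_all add: inner_vec_def sum_2)

lemma norm_frame_square: "(norm (a *\<^sub>R u + b *\<^sub>R rot90 u))\<^sup>2 = (a\<^sup>2 + b\<^sup>2) * (norm u)\<^sup>2"
  unfolding power2_norm_eq_inner by (simp add: inner_vec_def sum_2 power2_eq_square algebra_simps)

lemma norm_rot90 [simp]: "norm (rot90 u) = norm u"
  using norm_frame_square[of 0 u 1] by simp

lemma frame_expansion:
  assumes "norm e = 1"
  shows "(u \<bullet> e) *\<^sub>R e + (u \<bullet> rot90 e) *\<^sub>R rot90 e = u"
proof -
  have e: "e$1 * e$1 + e$2 * e$2 = 1"
    using assms by (simp add: norm_eq_1 inner_vec_def sum_2)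
  have "u$1 * (e$1 * e$1 + e$2 * e$2) = u$1" "u$2 * (e$1 * e$1 + e$2 * e$2) = u$2"
    by (simp_all add: e)
  then show ?thesis
    by (simp add: vec_eq_iff forall_2 inner_vec_def sum_2 algebra_simps)
qed

lemma orient_frame:
  assumes "norm e = 1"
  shows "orient (c + x1 *\<^sub>R e + y1 *\<^sub>R rot90 e) (c + x2 *\<^sub>R e + y2 *\<^sub>R rot90 e)
      (c + x3 *\<^sub>R e + y3 *\<^sub>R rot90 e) = (x2 - x1) * (y3 - y1) - (y2 - y1) * (x3 - x1)"
proof -
  have e: "e$1 * e$1 + e$2 * e$2 = 1"
    using assms by (simp add: norm_eq_1 inner_vec_def sum_2)
  have "orient (c + x1 *\<^sub>R e + y1 *\<^sub>R rot90 e) (c + x2 *\<^sub>R e + y2 *\<^sub>R rot90 e)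
      (c + x3 *\<^sub>R e + y3 *\<^sub>R rot90 e)
      = ((x2 - x1) * (y3 - y1) - (y2 - y1) * (x3 - x1)) * (e$1 * e$1 + e$2 * e$2)"
    by (simp add: orient_def algebra_simps)
  then show ?thesis
    by (simp add: e)
qed

text \<open>
  In the frame \<open>e, rot90 e\<close> at \<open>C\<close>, the circles through \<open>C = (0, 0)\<close> and \<open>D = (0, -d)\<close> are
  \<open>u\<^sup>2 + v\<^sup>2 + d v = s u\<close>, with centre \<open>(s / 2, - d / 2)\<close>. Then \<open>2 - d x'\<close> and \<open>d x'\<close>
  are the doubled areas of the triangles \<open>D A B\<close> and \<open>D B C\<close>.
\<close>

lemma unit_cyclic_quadrilateral_in_frame:
  assumes e: "norm e = 1"
    and A: "A = C + x *\<^sub>R e + y *\<^sub>R rot90 e"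
    and B: "B = C + x' *\<^sub>R e + y' *\<^sub>R rot90 e"
    and D: "D = C - d *\<^sub>R rot90 e"
    and d: "0 < d" and x: "0 < x" "0 < x'" "d * x' < 2"
    and area: "x * y' - x' * y = 2 - d * x"
    and circle: "(x'\<^sup>2 + y'\<^sup>2 + d * y') * x = (x\<^sup>2 + y\<^sup>2 + d * y) * x'"
  shows "cyclic_quadrilateral D A B C" "quadrilateral_area D A B C = 1"
proof -
  define s where "s = (x\<^sup>2 + y\<^sup>2 + d * y) / x"
  define c where "c = C + (s / 2) *\<^sub>R e - (d / 2) *\<^sub>R rot90 e"
  define r where "r = sqrt ((s / 2)\<^sup>2 + (d / 2)\<^sup>2)"
  have r: "0 < r"
    unfolding r_def using d by (intro real_sqrt_gt_zero add_nonneg_pos) auto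
  have on_circle: "C + u *\<^sub>R e + v *\<^sub>R rot90 e \<in> sphere c r" if "u\<^sup>2 + v\<^sup>2 + d * v = s * u" for u v
  proof -
    have diff: "c - (C + u *\<^sub>R e + v *\<^sub>R rot90 e) = (s / 2 - u) *\<^sub>R e + (- d / 2 - v) *\<^sub>R rot90 e"
      by (simp add: c_def scaleR_diff_left)
    have "(s / 2 - u)\<^sup>2 + (- d / 2 - v)\<^sup>2 = r\<^sup>2"
      using that by (simp add: r_def power2_eq_square algebra_simps)
    then have "(dist c (C + u *\<^sub>R e + v *\<^sub>R rot90 e))\<^sup>2 = r\<^sup>2"
      unfolding dist_norm diff norm_frame_square by (simp add: e)
    then show ?thesis
      using r by (simp add: power2_eq_iff_nonneg)
  qed
  have D': "D = C + 0 *\<^sub>R e + (- d) *\<^sub>R rot90 e" and C': "C = C + 0 *\<^sub>R e + 0 *\<^sub>R rot90 e"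
    by (simp_all add: D)
  have "A \<in> sphere c r"
    unfolding A by (rule on_circle) (use x in \<open>simp add: s_def\<close>)
  moreover have "B \<in> sphere c r"
    unfolding B by (rule on_circle) (use x circle in \<open>simp add: s_def field_simps\<close>)
  moreover have "D \<in> sphere c r"
    unfolding D' by (rule on_circle) (simp add: power2_eq_square)
  moreover have "C \<in> sphere c r"
    by (subst C', rule on_circle) simp
  ultimately have sph: "{D, A, B, C} \<subseteq> sphere c r"
    by blast
  have "orient D A B = (x - 0) * (y' - - d) - (y - - d) * (x' - 0)"
    unfolding A B D' by (rule orient_frame[OF e])
  also have "\<dots> = 2 - d * x'"
    using area by (simp add: algebra_simps)
  finally have DAB: "orient D A B = 2 - d * x'" .
  have "orient D B C = (x' - 0) * (0 - - d) - (y' - - d) * (0 - 0)"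
    using orient_frame[OF e, of C 0 "- d" x' y' 0 0] unfolding B D' by simp
  then have DBC: "orient D B C = d * x'"
    by simp
  have "0 < orient D A B" "0 < orient D B C"
    using DAB DBC d x by simp_all
  note quad = cyclic_quadrilateral_if_oriented[OF sph r this]
  show "cyclic_quadrilateral D A B C"
    by (rule quad(1))
  show "quadrilateral_area D A B C = 1"
    using quad(2) by (simp add: DAB DBC)
qed

section \<open>Unit cyclic quadrilaterals in sets of infinite measure\<close>

text \<open>
  The map \<open>x \<mapsto> x + t J x\<close>, with \<open>J\<close> the rotation by a right angle, scales distances by \<open>sqrt (1 + t\<^sup>2)\<close> and
  moves a bounded set arbitrarily little as \<open>t \<rightarrow> 0\<close>, so the recurrence principle applies to
  it. The last inequality makes \<open>C\<close> and its partner at most \<open>1 / (4 |C|)\<close> apart.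
\<close>

lemma close_perpendicular_pair_far_out:
  fixes S :: "(real^2) set"
  assumes S: "S \<in> sets lebesgue" "emeasure lebesgue S = \<infinity>"
  obtains C t where "C \<in> S" "C + t *\<^sub>R rot90 C \<in> S" "R < norm C" "0 < t" "4 * t * (norm C)\<^sup>2 \<le> 1"
proof -
  obtain K where K: "compact K" "K \<subseteq> S" "0 < measure lebesgue K" "\<And>x. x \<in> K \<Longrightarrow> R < norm x"
    using compact_of_positive_measure_far_out[OF S] by metis
  obtain b where b: "0 < b" "\<And>x. x \<in> K \<Longrightarrow> norm x \<le> b"
    using compact_imp_bounded[OF K(1)] by (auto simp: bounded_pos)
  obtain \<eta> where \<eta>: "0 < \<eta>"
    "\<And>f. \<lbrakk>\<And>x. x \<in> K \<Longrightarrow> dist x (f x) < \<eta>;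
          \<And>x y. x \<in> K \<Longrightarrow> y \<in> K \<Longrightarrow> dist x y \<le> 1 * dist (f x) (f y)\<rbrakk>
        \<Longrightarrow> \<exists>x\<in>K. f x \<in> K"
    using expanding_near_identity_recurrence[OF K(1,3) zero_less_one] by blast
  define t where "t = min (\<eta> / (2 * b)) (1 / (4 * b\<^sup>2))"
  have t: "0 < t" "t * b < \<eta>" "4 * t * b\<^sup>2 \<le> 1"
  proof -
    show "0 < t"
      using \<eta>(1) b(1) by (simp add: t_def)
    have "t * b \<le> \<eta> / (2 * b) * b"
      using b(1) by (intro mult_right_mono) (auto simp: t_def)
    then show "t * b < \<eta>"
      using b(1) \<eta>(1) by simp
    have "t * (4 * b\<^sup>2) \<le> 1 / (4 * b\<^sup>2) * (4 * b\<^sup>2)"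
      using b(1) by (intro mult_right_mono) (auto simp: t_def)
    then show "4 * t * b\<^sup>2 \<le> 1"
      using b(1) by (simp add: mult_ac)
  qed
  have "\<exists>x\<in>K. x + t *\<^sub>R rot90 x \<in> K"
  proof (rule \<eta>(2))
    fix x assume "x \<in> K"
    then have "t * norm x \<le> t * b"
      using b(2) t(1) by (intro mult_left_mono) auto
    with t(2) have "t * norm x < \<eta>"
      by linarith
    then show "dist x (x + t *\<^sub>R rot90 x) < \<eta>"
      using t(1) by (simp add: dist_norm)
  next
    fix x y :: "real^2"
    have "(norm (x - y))\<^sup>2 \<le> (1\<^sup>2 + t\<^sup>2) * (norm (x - y))\<^sup>2"
      by (simp add: distrib_right)
    also have "\<dots> = (norm (1 *\<^sub>R (x - y) + t *\<^sub>R rot90 (x - y)))\<^sup>2"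
      by (rule norm_frame_square[symmetric])
    also have "1 *\<^sub>R (x - y) + t *\<^sub>R rot90 (x - y) = (x + t *\<^sub>R rot90 x) - (y + t *\<^sub>R rot90 y)"
      by (simp add: rot90_diff scaleR_diff_right)
    finally show "dist x y \<le> 1 * dist (x + t *\<^sub>R rot90 x) (y + t *\<^sub>R rot90 y)"
      by (simp add: dist_norm power2_le_iff_abs_le)
  qed
  then obtain C where C: "C \<in> K" "C + t *\<^sub>R rot90 C \<in> K"
    by blast
  have "4 * t * (norm C)\<^sup>2 \<le> 4 * t * b\<^sup>2"
    using t(1) b(2)[OF C(1)] by (intro mult_left_mono power_mono) auto
  with t(3) have "4 * t * (norm C)\<^sup>2 \<le> 1"
    by linarith
  with C K t(1) show thesis
    by (intro that) auto
qed

theorem theorem1: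
  fixes S :: "(real^2) set"
  assumes "S \<in> sets lebesgue"
    and "emeasure lebesgue S = \<infinity>"
  shows "\<exists>A\<in>S. \<exists>B\<in>S. \<exists>C\<in>S. \<exists>D\<in>S.
    cyclic_quadrilateral A B C D \<and> quadrilateral_area A B C D = 1"
proof -
  obtain K where K: "compact K" "K \<subseteq> S" "0 < measure lebesgue K"
    using compact_of_positive_measure_far_out[OF assms] by metis
  obtain b where b: "\<And>x. x \<in> K \<Longrightarrow> norm x \<le> b"
    using compact_imp_bounded[OF K(1)] by (auto simp: bounded_iff)
  define M where "M = max 1 b"
  have M: "1 \<le> M" "\<And>x. x \<in> K \<Longrightarrow> norm x \<le> M"
    using b by (auto simp: M_def max.coboundedI2)
  obtain \<eta> where \<eta>: "0 < \<eta>"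
    "\<And>f. \<lbrakk>\<And>x. x \<in> K \<Longrightarrow> dist x (f x) < \<eta>;
          \<And>x y. x \<in> K \<Longrightarrow> y \<in> K \<Longrightarrow> dist x y \<le> 2 * dist (f x) (f y)\<rbrakk>
        \<Longrightarrow> \<exists>x\<in>K. f x \<in> K"
    using expanding_near_identity_recurrence[OF K(1,3) zero_less_numeral] by blast
  obtain C t where C: "C \<in> S" "C + t *\<^sub>R rot90 C \<in> S" "max (200 * M) (4 / \<eta>) < norm C"
    and t: "0 < t" "4 * t * (norm C)\<^sup>2 \<le> 1"
    using close_perpendicular_pair_far_out[OF assms] by metis
  \<comment> \<open>The frame vector \<open>e\<close> points from \<open>C\<close> to the origin, which thus has coordinates \<open>(R, 0)\<close>.\<close>
  define R e d where "R = norm C" and "e = (- 1 / norm C) *\<^sub>R C" and "d = t * norm C"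
  have R: "200 * M \<le> R" "4 / \<eta> < R" "0 < R"
    using C(3) M(1) by (auto simp: R_def)
  have e: "norm e = 1" and Ce: "C = (- R) *\<^sub>R e"
    using R(3) by (simp_all add: e_def R_def)
  have d: "0 < d" "4 * d * R \<le> 1"
    using t R(3) by (simp_all add: d_def R_def power2_eq_square mult_ac)
  obtain p q :: "real \<Rightarrow> real \<Rightarrow> real" where
      area: "\<And>x y. \<lbrakk>\<bar>x - R\<bar> \<le> M; \<bar>y\<bar> \<le> M\<rbrakk> \<Longrightarrow> 2 - d * x + y * p x y = x * q x y"
    and circle: "\<And>x y. \<lbrakk>\<bar>x - R\<bar> \<le> M; \<bar>y\<bar> \<le> M\<rbrakk> \<Longrightarrow>
        ((x + p x y)\<^sup>2 + (y + q x y)\<^sup>2 + d * (y + q x y)) * x = (x\<^sup>2 + y\<^sup>2 + d * y) * (x + p x y)"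
    and small: "\<And>x y. \<lbrakk>\<bar>x - R\<bar> \<le> M; \<bar>y\<bar> \<le> M\<rbrakk> \<Longrightarrow> \<bar>p x y\<bar> + \<bar>q x y\<bar> \<le> 4 / R"
    and lipschitz: "\<And>x y x' y'. \<lbrakk>\<bar>x - R\<bar> \<le> M; \<bar>y\<bar> \<le> M; \<bar>x' - R\<bar> \<le> M; \<bar>y'\<bar> \<le> M\<rbrakk> \<Longrightarrow>
        \<bar>p x y - p x' y'\<bar> + \<bar>q x y - q x' y'\<bar> \<le> 1 / 4 * (\<bar>x - x'\<bar> + \<bar>y - y'\<bar>)"
    by (rule unit_area_displacement[OF M(1) R(1) d]) (rule that)
  \<comment> \<open>Coordinates of \<open>A\<close> in that frame, and the map sending \<open>A\<close> to the fourth vertex \<open>B\<close>.\<close>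
  define X Y where "X A = (A - C) \<bullet> e" and "Y A = (A - C) \<bullet> rot90 e" for A
  define F where "F A = A + p (X A) (Y A) *\<^sub>R e + q (X A) (Y A) *\<^sub>R rot90 e" for A
  have ee: "e \<bullet> e = 1" "rot90 e \<bullet> rot90 e = 1"
    using e by (simp_all add: dot_square_norm)
  have XY: "\<bar>X A - R\<bar> \<le> M" "\<bar>Y A\<bar> \<le> M" if "A \<in> K" for A
  proof -
    have "X A - R = A \<bullet> e" "Y A = A \<bullet> rot90 e"
      by (simp_all add: X_def Y_def Ce inner_add_left ee)
    moreover have "\<bar>A \<bullet> e\<bar> \<le> norm A" "\<bar>A \<bullet> rot90 e\<bar> \<le> norm A"
      using Cauchy_Schwarz_ineq2[of A e] Cauchy_Schwarz_ineq2[of A "rot90 e"] e by simp_all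
    ultimately show "\<bar>X A - R\<bar> \<le> M" "\<bar>Y A\<bar> \<le> M"
      using M(2)[OF that] by linarith+
  qed
  have norm_comb: "norm (a *\<^sub>R e + a' *\<^sub>R rot90 e) \<le> \<bar>a\<bar> + \<bar>a'\<bar>" for a a'
    using norm_triangle_ineq[of "a *\<^sub>R e" "a' *\<^sub>R rot90 e"] e by simp
  have "\<exists>A\<in>K. F A \<in> K"
  proof (rule \<eta>(2))
    fix A assume A: "A \<in> K"
    have "dist A (F A) = norm (p (X A) (Y A) *\<^sub>R e + q (X A) (Y A) *\<^sub>R rot90 e)"
      unfolding F_def dist_norm by (subst norm_minus_commute) (simp add: algebra_simps)
    also have "\<dots> \<le> 4 / R"
      using norm_comb small[OF XY[OF A]] by (rule order_trans)
    also have "\<dots> < \<eta>"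
      using R \<eta>(1) by (simp add: field_simps)
    finally show "dist A (F A) < \<eta>" .
  next
    fix A B assume A: "A \<in> K" and B: "B \<in> K"
    define v where "v = (p (X A) (Y A) - p (X B) (Y B)) *\<^sub>R e + (q (X A) (Y A) - q (X B) (Y B)) *\<^sub>R rot90 e"
    have XYd: "X A - X B = (A - B) \<bullet> e" "Y A - Y B = (A - B) \<bullet> rot90 e"
      by (simp_all add: X_def Y_def inner_diff_left)
    have "norm v \<le> 1 / 4 * (\<bar>X A - X B\<bar> + \<bar>Y A - Y B\<bar>)"
      unfolding v_def using norm_comb lipschitz[OF XY[OF A] XY[OF B]] by (rule order_trans)
    also have "\<dots> \<le> 1 / 4 * (norm (A - B) + norm (A - B))"
      unfolding XYd using Cauchy_Schwarz_ineq2[of "A - B" e] Cauchy_Schwarz_ineq2[of "A - B" "rot90 e"] e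
      by (intro mult_left_mono add_mono) auto
    finally have "norm v \<le> 1 / 2 * norm (A - B)"
      by simp
    moreover have "F A - F B = (A - B) + v"
      by (simp add: F_def v_def scaleR_diff_left)
    moreover have "norm (A - B) - norm v \<le> norm ((A - B) + v)"
      using norm_triangle_ineq4[of "(A - B) + v" v] by simp
    ultimately show "dist A B \<le> 2 * dist (F A) (F B)"
      by (simp add: dist_norm)
  qed
  then obtain A where A: "A \<in> K" "F A \<in> K"
    by blast
  have X_F: "X (F A) = X A + p (X A) (Y A)"
    by (simp add: X_def F_def inner_diff_left inner_add_left ee)
  have "far_box M R d (X A) (Y A)" "far_box M R d (X (F A)) (Y (F A))"
    using XY[OF A(1)] XY[OF A(2)] M R d by (simp_all add: far_box_def)
  note box = this
  have pos: "0 < X A" "0 < X (F A)" "d * X (F A) < 2"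
    using far_box_bounds(2)[OF box(1)] far_box_bounds(2,8)[OF box(2)] R(3) by linarith+
  have frame_A: "A = C + X A *\<^sub>R e + Y A *\<^sub>R rot90 e"
    using frame_expansion[OF e, of "A - C"] by (simp add: X_def Y_def algebra_simps)
  have frame_FA: "F A = C + (X A + p (X A) (Y A)) *\<^sub>R e + (Y A + q (X A) (Y A)) *\<^sub>R rot90 e"
    unfolding F_def by (subst (1) frame_A) (simp add: scaleR_add_left)
  have frame_D: "C + t *\<^sub>R rot90 C = C - d *\<^sub>R rot90 e"
    unfolding d_def R_def[symmetric] by (subst (2) Ce) (simp add: vec_eq_iff forall_2)
  have "X A * (Y A + q (X A) (Y A)) - (X A + p (X A) (Y A)) * Y A = 2 - d * X A"
    using area[OF XY[OF A(1)]] by (simp add: algebra_simps)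
  note quad = unit_cyclic_quadrilateral_in_frame[OF e frame_A frame_FA frame_D d(1)
      pos[unfolded X_F] this circle[OF XY[OF A(1)]]]
  show ?thesis
    using quad A C(1,2) K(2) by blast
qed

end
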